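(* Suppose $\mathbf{G}(s)$ is a linear port-Hamiltonian system $\dot{\mathbf{x}}=(\mathbf{J}-\mathbf{R})\mathbf{Q}\mathbf{x}+\mathbf{B}\mathbf{u}$, $\mathbf{y}=\mathbf{B}^T\mathbf{Q}\mathbf{x}$, where $\mathbf{J},\mathbf{R},\mathbf{Q}\in\mathbb{R}^{n\times n}$, $\mathbf{B}\in\mathbb{R}^{n\times m}$, $\mathbf{J}=-\mathbf{J}^T$, $\mathbf{R}=\mathbf{R}^T\ge 0$, $\mathbf{Q}=\mathbf{Q}^T>0$, with two different port-Hamiltonian realizations $(\mathbf{J},\mathbf{R},\mathbf{Q},\mathbf{B})$ and $(\widetilde{\mathbf{J}},\widetilde{\mathbf{R}},\widetilde{\mathbf{Q}},\widetilde{\mathbf{B}})$ connected via a state-space transformation $\tilde{\mathbf{x}}=\mathbf{T}\mathbf{x}$ with $\mathbf{T}\in\mathbb{R}^{n\times n}$ invertible, that is, $$\widetilde{\mathbf{J}}=\mathbf{T}\mathbf{J}\mathbf{T}^T,\quad \widetilde{\mathbf{R}}=\mathbf{T}\mathbf{R}\mathbf{T}^T,\quad \widetilde{\mathbf{Q}}=\mathbf{T}^{-T}\mathbf{Q}\mathbf{T}^{-1},\quad \widetilde{\mathbf{B}}=\mathbf{T}\mathbf{B}.$$ Given a set of $r$ distinct interpolation points $\{s_i\}_{i=1}^r\subset\mathbb{C}$ with corresponding tangent directions $\{\mathbf{b}_i\}_{i=1}^r\subset\mathbb{C}^m$ (closed under conjugation), the interpolatory reduced-order port-Hamiltonian models produced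 from either realization via the structure-preserving interpolatory construction (defined in the context) will be identical to one another.
   Context: Following the usual convention, $\mathbf{G}(s)$ denotes both a dynamical system and its transfer function, and likewise $\mathbf{G}_r(s)$ for a reduced-order model. Structure-preserving interpolatory construction. Given a port-Hamiltonian realization $(\mathbf{J},\mathbf{R},\mathbf{Q},\mathbf{B})$, distinct points $s_i$ and directions $\mathbf{b}_i$, both sets closed under conjugation, form $$\mathbf{V}_r=\big[(s_1\mathbf{I}-(\mathbf{J}-\mathbf{R})\mathbf{Q})^{-1}\mathbf{B}\mathbf{b}_1,\ldots,(s_r\mathbf{I}-(\mathbf{J}-\mathbf{R})\mathbf{Q})^{-1}\mathbf{B}\mathbf{b}_r\big].$$ Let $\mathbf{M}\in\mathbb{C}^{r\times r}$ be any nonsingular matrix such that $\widehat{\mathbf{V}}_r=\mathbf{V}_r\mathbf{M}$ is real, set $\widehat{\mathbf{W}}_r=\mathbf{Q}\widehat{\mathbf{V}}_r(\widehat{\mathbf{V}}_r^T\mathbf{Q}\widehat{\mathbf{V}}_r)^{-1}$, and define $$\mathbf{J}_r=\widehat{\mathbf{W}}_r^T\mathbf{J}\widehat{\mathbf{W}}_r,\quad \mathbf{R}_r=\widehat{\mathbf{W}}_r^T\mathbf{R}\widehat{\mathbf{W}}_r,\quad \mathbf{Q}_r=\widehat{\mathbf{V}}_r^T\mathbf{Q}\widehat{\mathbf{V}}_r,\quad \mathbf{B}_r=\widehat{\mathbf{W}}_r^T\mathbf{B}.$$ The reduced-order port-Hamiltonian model is $\mathbf{G}_r(s)$: $\dot{\mathbf{x}}_r=(\mathbf{J}_r-\mathbf{R}_r)\mathbf{Q}_r\mathbf{x}_r+\mathbf{B}_r\mathbf{u}$,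 $\mathbf{y}_r=\mathbf{B}_r^T\mathbf{Q}_r\mathbf{x}_r$. It satisfies $\mathbf{G}(s_i)\mathbf{b}_i=\mathbf{G}_r(s_i)\mathbf{b}_i$ for $i=1,\ldots,r$. For the second realization the same construction is applied to $(\widetilde{\mathbf{J}},\widetilde{\mathbf{R}},\widetilde{\mathbf{Q}},\widetilde{\mathbf{B}})$. *)

theory Defs
  imports "HOL-Analysis.Analysis"
begin

definition pos_semidef :: "real^'n^'n \<Rightarrow> bool" where
  "pos_semidef A \<longleftrightarrow> transpose A = A \<and> (\<forall>x. 0 \<le> x \<bullet> (A *v x))"

definition pos_def :: "real^'n^'n \<Rightarrow> bool" where
  "pos_def A \<longleftrightarrow> transpose A = A \<and> (\<forall>x. x \<noteq> 0 \<longrightarrow> 0 < x \<bullet> (A *v x))"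

definition port_Hamiltonian ::
    "real^'n^'n \<Rightarrow> real^'n^'n \<Rightarrow> real^'n^'n \<Rightarrow> real^'m^'n \<Rightarrow> bool" where
  "port_Hamiltonian J R Q B \<longleftrightarrow> J = - transpose J \<and> pos_semidef R \<and> pos_def Q"

abbreviation cmat :: "real^'n^'m \<Rightarrow> complex^'n^'m" where
  "cmat \<equiv> map_matrix complex_of_real"

text \<open>The pencil \<open>z I - (J - R) Q\<close>; note that \<open>mat z\<close> is the scalar matrix \<open>z I\<close>.\<close>

definition ph_pencil ::
    "real^'n^'n \<Rightarrow> real^'n^'n \<Rightarrow> real^'n^'n \<Rightarrow> complex \<Rightarrow> complex^'n^'n" where
  "ph_pencil J R Q z = mat z - cmat ((J - R) ** Q)"

text \<open>The transfer function is undefined (\<open>None\<close>) where the pencil is singular, because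
  \<open>matrix_inv\<close> has no meaningful value there.  Equality of two transfer functions thus
  includes equality of their domains.\<close>

definition ph_transfer ::
    "real^'n^'n \<Rightarrow> real^'n^'n \<Rightarrow> real^'n^'n \<Rightarrow> real^'m^'n \<Rightarrow> complex \<Rightarrow> (complex^'m^'m) option" where
  "ph_transfer J R Q B z =
     (if invertible (ph_pencil J R Q z)
      then Some (cmat (transpose B ** Q) ** matrix_inv (ph_pencil J R Q z) ** cmat B)
      else None)"

definition interp_V ::
    "real^'n^'n \<Rightarrow> real^'n^'n \<Rightarrow> real^'n^'n \<Rightarrow> real^'m^'n \<Rightarrow>
     ('r::finite \<Rightarrow> complex) \<Rightarrow> ('r \<Rightarrow> complex^'m) \<Rightarrow> complex^'r^'n" where
  "interp_V J R Q B s b =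
     (\<chi> k i. (matrix_inv (ph_pencil J R Q (s i)) *v (cmat B *v b i)) $ k)"

definition admissible_M ::
    "real^'n^'n \<Rightarrow> real^'n^'n \<Rightarrow> real^'n^'n \<Rightarrow> real^'m^'n \<Rightarrow>
     ('r::finite \<Rightarrow> complex) \<Rightarrow> ('r \<Rightarrow> complex^'m) \<Rightarrow> complex^'r^'r \<Rightarrow> bool" where
  "admissible_M J R Q B s b M \<longleftrightarrow>
     invertible M \<and> (\<forall>k i. (interp_V J R Q B s b ** M) $ k $ i \<in> \<real>)"

text \<open>For admissible \<open>M\<close> the product below is real, so taking real parts only
  changes the type of its entries.\<close>

definition interp_Vhat ::
    "real^'n^'n \<Rightarrow> real^'n^'n \<Rightarrow> real^'n^'n \<Rightarrow> real^'m^'n \<Rightarrow>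
     ('r::finite \<Rightarrow> complex) \<Rightarrow> ('r \<Rightarrow> complex^'m) \<Rightarrow> complex^'r^'r \<Rightarrow> real^'r^'n" where
  "interp_Vhat J R Q B s b M = map_matrix Re (interp_V J R Q B s b ** M)"

definition interp_What ::
    "real^'n^'n \<Rightarrow> real^'n^'n \<Rightarrow> real^'n^'n \<Rightarrow> real^'m^'n \<Rightarrow>
     ('r::finite \<Rightarrow> complex) \<Rightarrow> ('r \<Rightarrow> complex^'m) \<Rightarrow> complex^'r^'r \<Rightarrow> real^'r^'n" where
  "interp_What J R Q B s b M =
     (let V = interp_Vhat J R Q B s b M
      in Q ** V ** matrix_inv (transpose V ** Q ** V))"

definition red_J ::
    "real^'n^'n \<Rightarrow> real^'n^'n \<Rightarrow> real^'n^'n \<Rightarrow> real^'m^'n \<Rightarrow>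
     ('r::finite \<Rightarrow> complex) \<Rightarrow> ('r \<Rightarrow> complex^'m) \<Rightarrow> complex^'r^'r \<Rightarrow> real^'r^'r" where
  "red_J J R Q B s b M =
     (let W = interp_What J R Q B s b M in transpose W ** J ** W)"

definition red_R ::
    "real^'n^'n \<Rightarrow> real^'n^'n \<Rightarrow> real^'n^'n \<Rightarrow> real^'m^'n \<Rightarrow>
     ('r::finite \<Rightarrow> complex) \<Rightarrow> ('r \<Rightarrow> complex^'m) \<Rightarrow> complex^'r^'r \<Rightarrow> real^'r^'r" where
  "red_R J R Q B s b M =
     (let W = interp_What J R Q B s b M in transpose W ** R ** W)"

definition red_Q ::
    "real^'n^'n \<Rightarrow> real^'n^'n \<Rightarrow> real^'n^'n \<Rightarrow> real^'m^'n \<Rightarrow>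
     ('r::finite \<Rightarrow> complex) \<Rightarrow> ('r \<Rightarrow> complex^'m) \<Rightarrow> complex^'r^'r \<Rightarrow> real^'r^'r" where
  "red_Q J R Q B s b M =
     (let V = interp_Vhat J R Q B s b M in transpose V ** Q ** V)"

definition red_B ::
    "real^'n^'n \<Rightarrow> real^'n^'n \<Rightarrow> real^'n^'n \<Rightarrow> real^'m^'n \<Rightarrow>
     ('r::finite \<Rightarrow> complex) \<Rightarrow> ('r \<Rightarrow> complex^'m) \<Rightarrow> complex^'r^'r \<Rightarrow> real^'m^'r" where
  "red_B J R Q B s b M = transpose (interp_What J R Q B s b M) ** B"

definition red_transfer ::
    "real^'n^'n \<Rightarrow> real^'n^'n \<Rightarrow> real^'n^'n \<Rightarrow> real^'m^'n \<Rightarrow>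
     ('r::finite \<Rightarrow> complex) \<Rightarrow> ('r \<Rightarrow> complex^'m) \<Rightarrow> complex^'r^'r \<Rightarrow>
     complex \<Rightarrow> (complex^'m^'m) option" where
  "red_transfer J R Q B s b M =
     ph_transfer (red_J J R Q B s b M) (red_R J R Q B s b M)
                 (red_Q J R Q B s b M) (red_B J R Q B s b M)"

text \<open>Points and directions are each required to be closed under conjugation as sets.
  The usual pairwise condition (\<open>s j = cnj (s i)\<close> implies that \<open>b j\<close> is the conjugate
  of \<open>b i\<close>) is a special case.\<close>

definition conj_closed ::
    "('r \<Rightarrow> complex) \<Rightarrow> ('r \<Rightarrow> complex^'m) \<Rightarrow> bool" where
  "conj_closed s b \<longleftrightarrow>
     (\<forall>z \<in> range s. cnj z \<in> range s) \<and>
     (\<forall>v \<in> range b. (\<chi> k. cnj (v $ k)) \<in> range b)"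

end

theory Submission
  imports Defs
begin

text \<open>
  A state-space transformation \<open>T\<close> conjugates the pencil, so it multiplies the basis
  \<open>V\<close> by \<open>T\<close>. Hence the same \<open>M\<close> is admissible for both realizations, \<open>What\<close> is
  multiplied by \<open>T\<^sup>-\<^sup>T\<close>, and \<open>T\<close> cancels in every reduced matrix. Two admissible choices of
  \<open>M\<close> differ by a real invertible change of basis \<open>N\<close>, because \<open>V\<close> has full column rank;
  the corresponding reduced models are then themselves related by the state-space
  transformation \<open>N\<^sup>-\<^sup>1\<close> and have the same transfer function.
\<close>

section \<open>Inverses and one-sided inverses of matrices\<close>

lemma matrix_mul_cancel:
  assumes "S ** T = mat 1"
  shows "A ** S ** T = A"
  by (metis assms matrix_mul_assoc matrix_mul_rid)

lemma matrix_inv_eqI: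
  fixes A B :: "'a::field^'n^'n"
  assumes "A ** B = mat 1"
  shows "matrix_inv A = B"
proof -
  have BA: "B ** A = mat 1"
    using assms by (rule matrix_left_right_inverse1)
  \<comment> \<open>\<open>matrix_inv\<close> is a choice operator, so it satisfies both inverse
    equations once a witness, here \<open>B\<close>, exists.\<close>
  have "A ** matrix_inv A = mat 1 \<and> matrix_inv A ** A = mat 1"
    unfolding matrix_inv_def by (rule someI[of _ B]) (simp add: assms BA)
  then show ?thesis
    by (metis BA matrix_mul_assoc matrix_mul_lid matrix_mul_rid)
qed

lemma matrix_mul_inv:
  fixes A :: "'a::field^'n^'n"
  assumes "invertible A"
  shows "A ** matrix_inv A = mat 1" "matrix_inv A ** A = mat 1"
proof -
  obtain B where B: "A ** B = mat 1" "B ** A = mat 1"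
    using assms by (auto simp: invertible_def)
  then show "A ** matrix_inv A = mat 1" "matrix_inv A ** A = mat 1"
    using matrix_inv_eqI[OF B(1)] by auto
qed

lemma matrix_mul_transpose_cancel:
  fixes S T :: "'a::comm_semiring_1^'n^'n"
  assumes "S ** T = mat 1"
  shows "transpose T ** transpose S = mat 1"
  by (metis assms matrix_transpose_mul transpose_mat)

text \<open>Full column rank equals full row rank, so the rows span the whole space, which is the
  span criterion for a left inverse.\<close>

lemma left_invertible_if_full_rank:
  fixes A :: "'a::field^'n^'m"
  assumes "rank A = CARD('n)"
  obtains L :: "'a^'m^'n" where "L ** A = mat 1"
proof -
  have "vec.dim (rows A) = vec.dimension TYPE('a) TYPE('n)"
    using assms by (simp add: row_rank_def_gen vec.dimension_def card_cart_basis)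
  then have "vec.span (rows A) = UNIV"
    by (simp add: vec.dim_eq_full)
  then show ?thesis
    using that by (auto simp: matrix_left_invertible_span_rows_gen[symmetric])
qed

section \<open>Real matrices inside complex ones\<close>

lemma cmat_mult: "cmat (A ** B) = cmat A ** cmat B"
  by (simp add: vec_eq_iff matrix_matrix_mult_def)

lemma cmat_mat_1 [simp]: "cmat (mat 1) = mat 1"
  by (simp add: vec_eq_iff mat_def)

lemma cmat_eq_iff [simp]: "cmat A = cmat B \<longleftrightarrow> A = B"
  by (simp add: vec_eq_iff)

lemma cmat_mult_eq_1:
  assumes "A ** B = mat 1"
  shows "cmat A ** cmat B = mat 1"
  by (metis assms cmat_mult cmat_mat_1)

lemma cmat_map_matrix_Re:
  assumes "\<And>i j. A $ i $ j \<in> \<real>"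
  shows "cmat (map_matrix Re A) = A"
  using assms by (simp add: vec_eq_iff)

lemma matrix_mul_scalar_commute: "A ** mat z = mat z ** (A :: 'a::comm_ring_1^'n^'m)"
  by (simp add: vec_eq_iff matrix_matrix_mult_def mat_def if_distrib if_distribR mult.commute
      cong: if_cong)

lemma matrix_mul_diff_distrib:
  fixes A :: "'a::ring_1^'n^'m"
  shows "A ** (B - C) = A ** B - A ** C" "(D - E) ** A = D ** A - E ** A"
  by (simp_all add: vec_eq_iff matrix_matrix_mult_def algebra_simps sum_subtractf)

text \<open>Lets a factor common to all columns of \<open>interp_V\<close> be pulled out.\<close>

lemma column_eq_matrix_mul: "(\<chi> k i. (A *v f i) $ k) = A ** (\<chi> k i. f i $ k)"
  by (simp add: vec_eq_iff matrix_matrix_mult_def matrix_vector_mult_def)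

section \<open>State-space transformations of the pencil and the transfer function\<close>

lemma ph_pencil_transform:
  fixes S T :: "real^'n^'n"
  assumes ST: "S ** T = mat 1"
  shows "ph_pencil (T ** J ** transpose T) (T ** R ** transpose T) (transpose S ** Q ** S) z
       = cmat T ** ph_pencil J R Q z ** cmat S"
proof -
  have TS: "T ** S = mat 1"
    using ST by (rule matrix_left_right_inverse1)
  have "(T ** J ** transpose T - T ** R ** transpose T) ** (transpose S ** Q ** S)
      = T ** ((J - R) ** Q) ** S"
    \<comment> \<open>\<open>matrix_mul_assoc\<close> brackets to the left, the shape in which
      \<open>matrix_mul_cancel\<close> removes an inverse pair inside a longer product; here
      \<open>transpose T ** transpose S\<close> vanishes.\<close>
    by (simp add: matrix_mul_diff_distrib matrix_mul_assoc
        matrix_mul_cancel[OF matrix_mul_transpose_cancel[OF ST]])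
  moreover have "cmat T ** mat z ** cmat S = mat z"
    by (simp add: matrix_mul_scalar_commute matrix_mul_cancel[OF cmat_mult_eq_1[OF TS]])
  ultimately show ?thesis
    by (simp add: ph_pencil_def cmat_mult matrix_mul_diff_distrib(1)[of "cmat T"]
        matrix_mul_diff_distrib(2)[of _ _ "cmat S"])
qed

lemma matrix_inv_ph_pencil_transform:
  fixes S T :: "real^'n^'n"
  assumes ST: "S ** T = mat 1" and inv: "invertible (ph_pencil J R Q z)"
  defines "P \<equiv> ph_pencil (T ** J ** transpose T) (T ** R ** transpose T) (transpose S ** Q ** S) z"
  shows "invertible P" "matrix_inv P = cmat T ** matrix_inv (ph_pencil J R Q z) ** cmat S"
proof -
  have cST: "cmat S ** cmat T = mat 1" and cTS: "cmat T ** cmat S = mat 1"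
    using ST matrix_left_right_inverse1[OF ST] by (auto intro: cmat_mult_eq_1)
  have *: "P ** (cmat T ** matrix_inv (ph_pencil J R Q z) ** cmat S) = mat 1"
    unfolding P_def ph_pencil_transform[OF ST]
    by (simp add: matrix_mul_assoc matrix_mul_cancel[OF cST]
        matrix_mul_cancel[OF matrix_mul_inv(1)[OF inv]] cTS)
  show "invertible P"
    using * by (auto simp: invertible_right_inverse)
  show "matrix_inv P = cmat T ** matrix_inv (ph_pencil J R Q z) ** cmat S"
    using * by (rule matrix_inv_eqI)
qed

text \<open>With \<open>S\<close> and \<open>T\<close> an arbitrary inverse pair, this also applies
  to reduced models, where it relates those of two choices of \<open>M\<close>.\<close>

lemma ph_transfer_transform:
  fixes S T :: "real^'n^'n"
  assumes ST: "S ** T = mat 1"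
  shows "ph_transfer (T ** J ** transpose T) (T ** R ** transpose T) (transpose S ** Q ** S) (T ** B)
       = ph_transfer J R Q B"
proof
  fix z
  have cST: "cmat S ** cmat T = mat 1" and cTS: "cmat T ** cmat S = mat 1"
    using ST matrix_left_right_inverse1[OF ST] by (auto intro: cmat_mult_eq_1)
  let ?P = "ph_pencil J R Q z"
  let ?P' = "ph_pencil (T ** J ** transpose T) (T ** R ** transpose T) (transpose S ** Q ** S) z"
  \<comment> \<open>The domains must agree too; undoing the similarity carries invertibility
    back.\<close>
  have "invertible ?P" if "invertible ?P'"
  proof -
    have "cmat S ** ?P' ** cmat T = ?P"
      by (simp add: ph_pencil_transform[OF ST] matrix_mul_assoc cST matrix_mul_cancel[OF cST])
    moreover have "invertible (cmat S)" "invertible (cmat T)"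
      using cST cTS by (auto simp: invertible_def)
    ultimately show ?thesis
      by (metis that invertible_mult)
  qed
  moreover have "cmat (transpose (T ** B) ** (transpose S ** Q ** S)) ** matrix_inv ?P' ** cmat (T ** B)
      = cmat (transpose B ** Q) ** matrix_inv ?P ** cmat B" if "invertible ?P"
    by (simp add: matrix_inv_ph_pencil_transform[OF ST that] matrix_transpose_mul matrix_mul_assoc
        cmat_mult matrix_mul_cancel[OF cST]
        matrix_mul_cancel[OF cmat_mult_eq_1[OF matrix_mul_transpose_cancel[OF ST]]])
  ultimately show "ph_transfer (T ** J ** transpose T) (T ** R ** transpose T)
      (transpose S ** Q ** S) (T ** B) z = ph_transfer J R Q B z"
    using matrix_inv_ph_pencil_transform(1)[OF ST] by (auto simp: ph_transfer_def)
qed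

section \<open>State-space transformations of the reduced model\<close>

lemma interp_V_transform:
  fixes S T :: "real^'n^'n"
  assumes ST: "S ** T = mat 1" and inv: "\<And>i. invertible (ph_pencil J R Q (s i))"
  shows "interp_V (T ** J ** transpose T) (T ** R ** transpose T) (transpose S ** Q ** S) (T ** B) s b
       = cmat T ** interp_V J R Q B s b"
  unfolding interp_V_def
  by (subst column_eq_matrix_mul[symmetric])
    (simp add: matrix_inv_ph_pencil_transform(2)[OF ST inv] matrix_vector_mul_assoc
      matrix_mul_assoc cmat_mult matrix_mul_cancel[OF cmat_mult_eq_1[OF ST]])

lemma cmat_mult_Reals:
  assumes "\<And>i j. A $ i $ j \<in> \<real>"
  shows "(cmat T ** A) $ i $ j \<in> \<real>"
  using assms by (auto simp: matrix_matrix_mult_def intro!: sum_in_Reals Reals_mult)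

lemma admissible_M_transform:
  fixes S T :: "real^'n^'n"
  assumes ST: "S ** T = mat 1" and inv: "\<And>i. invertible (ph_pencil J R Q (s i))"
  shows "admissible_M (T ** J ** transpose T) (T ** R ** transpose T) (transpose S ** Q ** S) (T ** B) s b M
     \<longleftrightarrow> admissible_M J R Q B s b M"
proof -
  let ?A = "interp_V J R Q B s b ** M"
  \<comment> \<open>Each of \<open>?A\<close> and \<open>cmat T ** ?A\<close> is a real matrix times
    the other, so both are real or neither is.\<close>
  have "?A = cmat S ** (cmat T ** ?A)"
    by (simp add: matrix_mul_assoc cmat_mult_eq_1[OF ST])
  then have "(\<forall>k i. (cmat T ** ?A) $ k $ i \<in> \<real>) \<longleftrightarrow> (\<forall>k i. ?A $ k $ i \<in> \<real>)"
    by (metis cmat_mult_Reals)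
  then show ?thesis
    by (simp only: admissible_M_def interp_V_transform[OF ST inv] matrix_mul_assoc)
qed

lemma cmat_interp_Vhat:
  assumes "admissible_M J R Q B s b M"
  shows "cmat (interp_Vhat J R Q B s b M) = interp_V J R Q B s b ** M"
  using assms by (auto simp: admissible_M_def interp_Vhat_def intro: cmat_map_matrix_Re)

lemma interp_Vhat_transform:
  fixes S T :: "real^'n^'n"
  assumes ST: "S ** T = mat 1" and inv: "\<And>i. invertible (ph_pencil J R Q (s i))"
    and M: "admissible_M J R Q B s b M"
  shows "interp_Vhat (T ** J ** transpose T) (T ** R ** transpose T) (transpose S ** Q ** S) (T ** B) s b M
       = T ** interp_Vhat J R Q B s b M"
proof -
  have M': "admissible_M (T ** J ** transpose T) (T ** R ** transpose T)
      (transpose S ** Q ** S) (T ** B) s b M"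
    using M by (simp add: admissible_M_transform[OF ST inv])
  show ?thesis
    by (subst cmat_eq_iff[symmetric])
      (simp only: cmat_interp_Vhat[OF M'] cmat_interp_Vhat[OF M] cmat_mult
        interp_V_transform[OF ST inv] matrix_mul_assoc)
qed

lemma red_Q_transform:
  fixes S T :: "real^'n^'n"
  assumes ST: "S ** T = mat 1" and inv: "\<And>i. invertible (ph_pencil J R Q (s i))"
    and M: "admissible_M J R Q B s b M"
  shows "red_Q (T ** J ** transpose T) (T ** R ** transpose T) (transpose S ** Q ** S) (T ** B) s b M
       = red_Q J R Q B s b M"
  by (simp add: red_Q_def Let_def interp_Vhat_transform[OF assms] matrix_transpose_mul
      matrix_mul_assoc matrix_mul_cancel[OF ST]
      matrix_mul_cancel[OF matrix_mul_transpose_cancel[OF ST]])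

lemma interp_What_eq:
  "interp_What J R Q B s b M
     = Q ** interp_Vhat J R Q B s b M ** matrix_inv (red_Q J R Q B s b M)"
  by (simp add: interp_What_def red_Q_def Let_def)

text \<open>\<open>S\<close> cancels against the \<open>T\<close> in the transformed
  \<open>interp_Vhat\<close>, and the inverse factor is unchanged because \<open>red_Q\<close>
  is.\<close>

lemma interp_What_transform:
  fixes S T :: "real^'n^'n"
  assumes ST: "S ** T = mat 1" and inv: "\<And>i. invertible (ph_pencil J R Q (s i))"
    and M: "admissible_M J R Q B s b M"
  shows "interp_What (T ** J ** transpose T) (T ** R ** transpose T) (transpose S ** Q ** S) (T ** B) s b M
       = transpose S ** interp_What J R Q B s b M"
  by (simp add: interp_What_eq red_Q_transform[OF assms] interp_Vhat_transform[OF assms]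
      matrix_mul_assoc matrix_mul_cancel[OF ST])

lemma red_JRB_transform:
  fixes S T :: "real^'n^'n"
  assumes ST: "S ** T = mat 1" and inv: "\<And>i. invertible (ph_pencil J R Q (s i))"
    and M: "admissible_M J R Q B s b M"
  shows "red_J (T ** J ** transpose T) (T ** R ** transpose T) (transpose S ** Q ** S) (T ** B) s b M
       = red_J J R Q B s b M"
    and "red_R (T ** J ** transpose T) (T ** R ** transpose T) (transpose S ** Q ** S) (T ** B) s b M
       = red_R J R Q B s b M"
    and "red_B (T ** J ** transpose T) (T ** R ** transpose T) (transpose S ** Q ** S) (T ** B) s b M
       = red_B J R Q B s b M"
  by (simp_all add: red_J_def red_R_def red_B_def Let_def interp_What_transform[OF assms]
      matrix_transpose_mul matrix_mul_assoc matrix_mul_cancel[OF ST]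
      matrix_mul_cancel[OF matrix_mul_transpose_cancel[OF ST]])

section \<open>Full column rank and independence of \<open>M\<close>\<close>

lemma invertible_congruence_pos_def:
  fixes Q :: "real^'n^'n" and V :: "real^'r^'n"
  assumes Q: "pos_def Q" and V: "inj ((*v) V)"
  shows "invertible (transpose V ** Q ** V)"
proof -
  have "x = 0" if x: "(transpose V ** Q ** V) *v x = 0" for x
  proof -
    \<comment> \<open>A kernel vector \<open>x\<close> makes the quadratic form of \<open>Q\<close>
      vanish at \<open>V *v x\<close>.\<close>
    have "(V *v x) \<bullet> (Q *v (V *v x)) = x \<bullet> ((transpose V ** Q ** V) *v x)"
      by (metis dot_lmul_matrix inner_commute matrix_vector_mul_assoc transpose_matrix_vector)
    then have "V *v x = 0"
      using Q x by (auto simp: pos_def_def)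
    then show "x = 0"
      using V by (metis injD matrix_vector_mult_0_right)
  qed
  then show ?thesis
    by (simp add: invertible_left_inverse matrix_left_invertible_ker)
qed

text \<open>A left inverse of \<open>interp_V\<close> and the inverse of \<open>M\<close> give a
  complex left inverse of \<open>interp_Vhat\<close>; injectivity is then restricted to real
  vectors.\<close>

lemma inj_interp_Vhat:
  fixes s :: "'r::finite \<Rightarrow> complex"
  assumes rank: "rank (interp_V J R Q B s b) = CARD('r)"
    and M: "admissible_M J R Q B s b M"
  shows "inj ((*v) (interp_Vhat J R Q B s b M))"
proof -
  obtain L where L: "L ** interp_V J R Q B s b = mat 1"
    using rank by (rule left_invertible_if_full_rank)
  have "invertible M"
    using M by (simp add: admissible_M_def)
  then have "(matrix_inv M ** L) ** cmat (interp_Vhat J R Q B s b M) = mat 1"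
    by (simp add: cmat_interp_Vhat[OF M] matrix_mul_assoc matrix_mul_cancel[OF L] matrix_mul_inv)
  then have inj: "inj ((*v) (cmat (interp_Vhat J R Q B s b M)))"
    by (auto simp flip: matrix_left_invertible_injective)
  have cvec: "cmat A *v (\<chi> i. complex_of_real (x $ i)) = (\<chi> i. complex_of_real ((A *v x) $ i))"
    for A :: "real^'r^'n" and x
    by (simp add: vec_eq_iff matrix_vector_mult_def)
  show ?thesis
  proof (rule injI)
    fix x y :: "real^'r"
    assume "interp_Vhat J R Q B s b M *v x = interp_Vhat J R Q B s b M *v y"
    then have "(\<chi> i. complex_of_real (x $ i)) = (\<chi> i. complex_of_real (y $ i))"
      by (intro injD[OF inj]) (simp add: cvec)
    then show "x = y"
      by (simp add: vec_eq_iff)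
  qed
qed

text \<open>The complex change of basis \<open>matrix_inv M ** M'\<close> is real, because a real
  left inverse \<open>L\<close> recovers it as \<open>L\<close> times the second basis.\<close>

lemma interp_Vhat_change_of_basis:
  fixes s :: "'r::finite \<Rightarrow> complex"
  assumes rank: "rank (interp_V J R Q B s b) = CARD('r)"
    and M: "admissible_M J R Q B s b M" and M': "admissible_M J R Q B s b M'"
  obtains N where "interp_Vhat J R Q B s b M' = interp_Vhat J R Q B s b M ** N"
proof -
  obtain L where L: "L ** interp_Vhat J R Q B s b M = mat 1"
    using inj_interp_Vhat[OF rank M] by (auto simp flip: matrix_left_invertible_injective)
  have inv: "invertible M"
    using M by (simp add: admissible_M_def)
  define P where "P = matrix_inv M ** M'"
  have VP: "cmat (interp_Vhat J R Q B s b M') = cmat (interp_Vhat J R Q B s b M) ** P"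
    by (simp add: P_def cmat_interp_Vhat[OF M] cmat_interp_Vhat[OF M'] matrix_mul_assoc
        matrix_mul_cancel[OF matrix_mul_inv(1)[OF inv]])
  have "cmat (L ** interp_Vhat J R Q B s b M') = P"
    by (simp add: cmat_mult VP matrix_mul_assoc cmat_mult_eq_1[OF L])
  then have "cmat (interp_Vhat J R Q B s b M')
      = cmat (interp_Vhat J R Q B s b M ** (L ** interp_Vhat J R Q B s b M'))"
    using VP by (simp add: cmat_mult)
  then show ?thesis
    using that by (simp only: cmat_eq_iff)
qed

lemma red_transfer_independent:
  fixes s :: "'r::finite \<Rightarrow> complex"
  assumes Q: "pos_def Q" and rank: "rank (interp_V J R Q B s b) = CARD('r)"
    and M: "admissible_M J R Q B s b M" and M': "admissible_M J R Q B s b M'"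
  shows "red_transfer J R Q B s b M' = red_transfer J R Q B s b M"
proof -
  let ?V = "interp_Vhat J R Q B s b M" and ?V' = "interp_Vhat J R Q B s b M'"
  let ?W = "interp_What J R Q B s b M" and ?W' = "interp_What J R Q B s b M'"
  let ?Q = "red_Q J R Q B s b M" and ?Q' = "red_Q J R Q B s b M'"
  obtain N where N: "?V' = ?V ** N"
    using interp_Vhat_change_of_basis[OF rank M M'] .
  obtain L where "L ** ?V' = mat 1"
    using inj_interp_Vhat[OF rank M'] by (auto simp flip: matrix_left_invertible_injective)
  \<comment> \<open>A left inverse of \<open>?V ** N\<close> also yields one of the square matrix
    \<open>N\<close>, which is therefore invertible.\<close>
  then have KN: "(L ** ?V) ** N = mat 1"
    by (simp add: N matrix_mul_assoc)
  define K where "K = L ** ?V"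
  have NK: "N ** K = mat 1"
    using matrix_left_right_inverse1[OF KN] by (simp add: K_def)
  have invQ: "invertible ?Q"
    unfolding red_Q_def Let_def
    by (rule invertible_congruence_pos_def[OF Q inj_interp_Vhat[OF rank M]])
  have Q': "?Q' = transpose N ** ?Q ** N"
    by (simp add: red_Q_def Let_def N matrix_transpose_mul matrix_mul_assoc)
  \<comment> \<open>The candidate inverse comes from inverting \<open>transpose N ** ?Q ** N\<close>
    factor by factor.\<close>
  have "?Q' ** (K ** matrix_inv ?Q ** transpose K) = mat 1"
    by (simp add: Q' matrix_mul_assoc matrix_mul_cancel[OF NK]
        matrix_mul_cancel[OF matrix_mul_inv(1)[OF invQ]]
        matrix_mul_transpose_cancel[OF KN[folded K_def]])
  then have "matrix_inv ?Q' = K ** matrix_inv ?Q ** transpose K"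
    by (rule matrix_inv_eqI)
  then have W': "?W' = ?W ** transpose K"
    by (simp add: interp_What_eq N matrix_mul_assoc matrix_mul_cancel[OF NK])
  \<comment> \<open>Together with \<open>Q'\<close>, these say that the two reduced models differ by
    the state-space transformation \<open>K\<close>, with inverse \<open>N\<close>.\<close>
  have "red_J J R Q B s b M' = K ** red_J J R Q B s b M ** transpose K"
    "red_R J R Q B s b M' = K ** red_R J R Q B s b M ** transpose K"
    "red_B J R Q B s b M' = K ** red_B J R Q B s b M"
    by (simp_all add: red_J_def red_R_def red_B_def Let_def W' matrix_transpose_mul matrix_mul_assoc)
  then show ?thesis
    by (simp add: red_transfer_def Q' ph_transfer_transform[OF NK])
qed

theorem theorem9:
  fixes J R Q J' R' Q' T :: "real^'n^'n"
    and B B' :: "real^'m^'n"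
    and s :: "'r::finite \<Rightarrow> complex"
    and b :: "'r \<Rightarrow> complex^'m"
  assumes "port_Hamiltonian J R Q B"
    and "port_Hamiltonian J' R' Q' B'"
    and "invertible T"
    and "J' = T ** J ** transpose T"
    and "R' = T ** R ** transpose T"
    and "Q' = transpose (matrix_inv T) ** Q ** matrix_inv T"
    and "B' = T ** B"
    and "inj s"
    and "conj_closed s b"
    and "\<And>i. invertible (ph_pencil J R Q (s i))"
    and "rank (interp_V J R Q B s b) = CARD('r)"
  shows "(\<forall>M. admissible_M J R Q B s b M \<longleftrightarrow> admissible_M J' R' Q' B' s b M) \<and>
         (\<forall>M. admissible_M J R Q B s b M \<longrightarrow>
            red_J J R Q B s b M = red_J J' R' Q' B' s b M \<and>
            red_R J R Q B s b M = red_R J' R' Q' B' s b M \<and>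
            red_Q J R Q B s b M = red_Q J' R' Q' B' s b M \<and>
            red_B J R Q B s b M = red_B J' R' Q' B' s b M) \<and>
         (\<forall>M M'. admissible_M J R Q B s b M \<longrightarrow> admissible_M J' R' Q' B' s b M' \<longrightarrow>
            red_transfer J R Q B s b M = red_transfer J' R' Q' B' s b M')"
proof -
  have ST: "matrix_inv T ** T = mat 1"
    using assms(3) by (rule matrix_mul_inv)
  have Q: "pos_def Q"
    using assms(1) by (simp add: port_Hamiltonian_def)
  note inv = assms(10) and rank = assms(11)
  have admissible: "admissible_M J' R' Q' B' s b M \<longleftrightarrow> admissible_M J R Q B s b M" for M
    unfolding assms(4-7) by (rule admissible_M_transform[OF ST inv])
  have red: "red_J J R Q B s b M = red_J J' R' Q' B' s b M"
    "red_R J R Q B s b M = red_R J' R' Q' B' s b M"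
    "red_Q J R Q B s b M = red_Q J' R' Q' B' s b M"
    "red_B J R Q B s b M = red_B J' R' Q' B' s b M"
    if "admissible_M J R Q B s b M" for M
    unfolding assms(4-7)
    by (simp_all only: red_Q_transform[OF ST inv that] red_JRB_transform[OF ST inv that])
  \<comment> \<open>At \<open>M'\<close> both realizations have the same reduced matrices, so only
    independence of the choice within the first realization remains.\<close>
  have "red_transfer J R Q B s b M = red_transfer J' R' Q' B' s b M'"
    if "admissible_M J R Q B s b M" "admissible_M J R Q B s b M'" for M M'
    using red_transfer_independent[OF Q rank that(2) that(1)] red[OF that(2)]
    by (simp add: red_transfer_def)
  then show ?thesis
    using admissible red by blast
qed

end
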